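(* Let $X$ be an infinite connected Hausdorff space which has at least one noncut point. If $\mathscr{F}(X\setminus\{p\})$ has a continuous selection for each noncut point $p$ of $X$, then $X$ is compact and orderable.
   Context: A point $p$ of a connected space $X$ is a noncut point if $X\setminus\{p\}$ is connected. For a topological space $Z$, $\mathscr{F}(Z)$ is the set of all nonempty closed subsets of $Z$, endowed with the Vietoris topology, i.e. the topology generated by all collections $\langle\mathscr{V}\rangle=\{S\in\mathscr{F}(Z): S\subset\bigcup\mathscr{V}\text{ and }S\cap V\neq\varnothing\text{ for every }V\in\mathscr{V}\}$, where $\mathscr{V}$ runs over the finite families of open subsets of $Z$. The set $X\setminus\{p\}$ carries the subspace topology. A selection for $\mathscr{F}(Z)$ is a map $f:\mathscr{F}(Z)\to Z$ with $f(S)\in S$ for all $S\in\mathscr{F}(Z)$; it is continuous if it is continuous with respect to the Vietoris topology on $\mathscr{F}(Z)$. A space is orderable if its topology is the open interval topology $\mathscr{T}_\leq$ generated by some linear order $\leq$ on it (the topology generated by the open rays $\{y: y<x\}$ and $\{y: x<y\}$). *)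

theory Defs
  imports "HOL-Analysis.Analysis"
begin

definition noncut_point :: "'a topology \<Rightarrow> 'a \<Rightarrow> bool" where
  "noncut_point X p \<longleftrightarrow> p \<in> topspace X \<and> connectedin X (topspace X - {p})"

definition nonempty_closed_sets :: "'a topology \<Rightarrow> 'a set set" where
  "nonempty_closed_sets Z = {S. closedin Z S \<and> S \<noteq> {}}"

definition vietoris_basic :: "'a topology \<Rightarrow> 'a set set \<Rightarrow> 'a set set" where
  "vietoris_basic Z \<V> =
     {S \<in> nonempty_closed_sets Z. S \<subseteq> \<Union>\<V> \<and> (\<forall>V\<in>\<V>. S \<inter> V \<noteq> {})}"

definition vietoris_topology :: "'a topology \<Rightarrow> 'a set topology" where
  "vietoris_topology Z =
     topology_generated_by {vietoris_basic Z \<V> | \<V>. finite \<V> \<and> (\<forall>V\<in>\<V>. openin Z V)}"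

lemma topspace_vietoris_topology [simp]:
  "topspace (vietoris_topology Z) = nonempty_closed_sets Z"
proof -
  have "vietoris_basic Z {topspace Z} = nonempty_closed_sets Z"
    by (auto simp: vietoris_basic_def nonempty_closed_sets_def dest: closedin_subset)
  then have "nonempty_closed_sets Z
      \<in> {vietoris_basic Z \<V> | \<V>. finite \<V> \<and> (\<forall>V\<in>\<V>. openin Z V)}"
    by (auto intro!: exI[of _ "{topspace Z}"])
  moreover have "vietoris_basic Z \<V> \<subseteq> nonempty_closed_sets Z" for \<V>
    by (auto simp: vietoris_basic_def)
  ultimately show ?thesis
    unfolding vietoris_topology_def topology_generated_by_topspace by blast
qed

definition continuous_selection :: "'a topology \<Rightarrow> ('a set \<Rightarrow> 'a) \<Rightarrow> bool" where
  "continuous_selection Z f \<longleftrightarrow>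
     continuous_map (vietoris_topology Z) Z f \<and> (\<forall>S\<in>nonempty_closed_sets Z. f S \<in> S)"

text \<open>
  The carrier is added to the subbase because \<open>topology_generated_by\<close> takes
  the union of the subbase as its carrier, and on a one-point set all open rays are empty.
\<close>

definition open_interval_topology :: "'a set \<Rightarrow> 'a rel \<Rightarrow> 'a topology" where
  "open_interval_topology A r =
     topology_generated_by (insert A (underS r ` A \<union> aboveS r ` A))"

lemma topspace_open_interval_topology [simp]:
  assumes "linear_order_on A r"
  shows "topspace (open_interval_topology A r) = A"
  using assms
  unfolding open_interval_topology_def topology_generated_by_topspace
  by (auto simp: underS_def aboveS_def order_on_defs)

definition orderable_space :: "'a topology \<Rightarrow> bool" where
  "orderable_space X \<longleftrightarrow>
     (\<exists>r. linear_order_on (topspace X) r \<and> X = open_interval_topology (topspace X) r)"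

end

(*
  A continuous selection on a connected Hausdorff space Y is the minimum with respect to a linear
  order whose open rays are open in Y. So if p is noncut, X - {p} is ordered with a first point q,
  and every closed set has a minimum; q is again noncut, and X - {q} is ordered in the same way.
  The connected set X - {p, q} carries only one such order up to reversal, and p is an end of
  X - {q}. Of the four resulting configurations, the good one has p and q as opposite ends of X:
  closed sets then have both minima and maxima, which forces compactness and the interval topology.
  The others are impossible; in the most delicate one p and q are limits at the same end, and the
  third order, obtained from the other (noncut) end r, would have to separate p from q by a point
  although both are limits of a connected set avoiding that point.
*)
theory Submission
  imports Defs
begin

section \<open>Weakly ordered spaces\<close>

text \<open>The order is strict and relative to the carrier, so it restricts to subspaces unchanged.
  Its rays are open in \<open>X\<close>, but they need not generate the topology of
  \<open>X\<close>.\<close>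

locale weakly_ordered =
  fixes X :: "'a topology" and lt :: "'a \<Rightarrow> 'a \<Rightarrow> bool"
  assumes irrefl: "x \<in> topspace X \<Longrightarrow> \<not> lt x x"
    and trans: "\<lbrakk>x \<in> topspace X; y \<in> topspace X; z \<in> topspace X; lt x y; lt y z\<rbrakk> \<Longrightarrow> lt x z"
    and total: "\<lbrakk>x \<in> topspace X; y \<in> topspace X; x \<noteq> y\<rbrakk> \<Longrightarrow> lt x y \<or> lt y x"
    and open_below: "x \<in> topspace X \<Longrightarrow> openin X {y \<in> topspace X. lt y x}"
    and open_above: "x \<in> topspace X \<Longrightarrow> openin X {y \<in> topspace X. lt x y}"

text \<open>For the converse relation the same predicate expresses the existence of maxima; both
  readings occur below.\<close>

definition closed_sets_have_least :: "'a topology \<Rightarrow> ('a \<Rightarrow> 'a \<Rightarrow> bool) \<Rightarrow> bool" where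
  "closed_sets_have_least X lt \<longleftrightarrow>
     (\<forall>S. closedin X S \<longrightarrow> S \<noteq> {} \<longrightarrow> (\<exists>m\<in>S. \<forall>s\<in>S. s \<noteq> m \<longrightarrow> lt m s))"

lemma closed_sets_have_leastE:
  assumes "closed_sets_have_least X lt" "closedin X S" "S \<noteq> {}"
  obtains m where "m \<in> S" "\<And>s. s \<in> S \<Longrightarrow> s \<noteq> m \<Longrightarrow> lt m s"
proof -
  have "\<exists>m\<in>S. \<forall>s\<in>S. s \<noteq> m \<longrightarrow> lt m s"
    using assms(1)[unfolded closed_sets_have_least_def, rule_format, OF assms(2,3)] .
  then show thesis
    using that by auto
qed

lemma weakly_ordered_subtopology:
  assumes "weakly_ordered X lt"
  shows "weakly_ordered (subtopology X S) lt"
proof -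
  interpret weakly_ordered X lt by fact
  have open_Int: "openin (subtopology X S) {y \<in> topspace (subtopology X S). P y}"
    if "openin X {y \<in> topspace X. P y}" for P
  proof -
    have "{y \<in> topspace (subtopology X S). P y} = {y \<in> topspace X. P y} \<inter> S"
      by auto
    then show ?thesis
      using that by (simp only: openin_subtopology_Int)
  qed
  show ?thesis
  proof unfold_locales
    fix x assume x: "x \<in> topspace (subtopology X S)"
    show "openin (subtopology X S) {y \<in> topspace (subtopology X S). lt y x}"
      "openin (subtopology X S) {y \<in> topspace (subtopology X S). lt x y}"
      by (intro open_Int open_below open_above; use x in simp)+
  next
    show "lt x z" if "x \<in> topspace (subtopology X S)" "y \<in> topspace (subtopology X S)"
      "z \<in> topspace (subtopology X S)" "lt x y" "lt y z" for x y z
      using trans[of x y z] that by simp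
    show "lt x y \<or> lt y x" if "x \<in> topspace (subtopology X S)" "y \<in> topspace (subtopology X S)"
      "x \<noteq> y" for x y
      using total[of x y] that by simp
    show "\<not> lt x x" if "x \<in> topspace (subtopology X S)" for x
      using irrefl[of x] that by simp
  qed
qed

lemma weakly_ordered_converse:
  assumes "weakly_ordered X lt"
  shows "weakly_ordered X (\<lambda>x y. lt y x)"
proof -
  interpret weakly_ordered X lt by fact
  show ?thesis
  proof unfold_locales
    show "lt z x" if "x \<in> topspace X" "y \<in> topspace X" "z \<in> topspace X" "lt y x" "lt z y" for x y z
      using trans[OF that(3,2,1,5,4)] .
    show "lt y x \<or> lt x y" if "x \<in> topspace X" "y \<in> topspace X" "x \<noteq> y" for x y
      using total[OF that] by blast
  qed (fact irrefl open_below open_above)+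
qed

text \<open>If \<open>U\<close> and \<open>V\<close> separate \<open>insert x A\<close> with
  \<open>x\<close> in \<open>U\<close>, then the trace of \<open>V\<close> lies in \<open>A\<close>
  and is open, and its complement \<open>U \<union> B\<close> is open too. This is a proper clopen
  set.\<close>

lemma connectedin_insert_complement_piece:
  assumes "connected_space X" "x \<in> topspace X" "openin X A" "openin X B"
    and "A \<inter> B = {}" "A \<union> B = topspace X - {x}"
  shows "connectedin X (insert x A)"
proof -
  have ins: "insert x A = topspace X - B" "insert x B = topspace X - A"
    using assms openin_subset[of X A] openin_subset[of X B] by blast+
  have sep: False
    if U: "openin X U" and V: "openin X V" and cov: "insert x A \<subseteq> U \<union> V"
      and dis: "U \<inter> V \<inter> insert x A = {}" and ne: "V \<inter> insert x A \<noteq> {}" and xU: "x \<in> U"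
    for U V
  proof -
    have "V \<inter> insert x A = V \<inter> A"
      using dis xU by blast
    then have "openin X (V \<inter> insert x A)"
      using V assms(3) by auto
    moreover have "topspace X - (V \<inter> insert x A) = U \<union> B"
    proof -
      have "topspace X = insert x A \<union> B" "insert x A \<inter> B = {}"
        using ins assms(2,5,6) by auto
      then show ?thesis
        using cov dis openin_subset[OF U] by auto
    qed
    then have "openin X (topspace X - (V \<inter> insert x A))"
      using U assms(4) by auto
    then have "closedin X (V \<inter> insert x A)"
      using openin_subset[OF V] ins by (auto simp: closedin_def)
    ultimately have "V \<inter> insert x A = topspace X"
      using assms(1) ne unfolding connected_space_clopen_in by blast
    then show False
      using assms(2) dis xU by blast
  qed
  have "insert x A \<subseteq> topspace X"
    using ins by auto
  moreover have "\<not> (\<exists>U V. openin X U \<and> openin X V \<and> insert x A \<subseteq> U \<union> V \<and>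
      U \<inter> V \<inter> insert x A = {} \<and> U \<inter> insert x A \<noteq> {} \<and> V \<inter> insert x A \<noteq> {})"
  proof clarify
    fix U V
    assume *: "openin X U" "openin X V" "insert x A \<subseteq> U \<union> V" "U \<inter> V \<inter> insert x A = {}"
      "U \<inter> insert x A \<noteq> {}" "V \<inter> insert x A \<noteq> {}"
    then consider "x \<in> U" | "x \<in> V" by blast
    then show False
      using sep[of U V] sep[of V U] * by (cases; simp add: Un_commute Int_commute)
  qed
  ultimately show ?thesis
    unfolding connectedin by blast
qed

text \<open>A finite set is closed in a Hausdorff space, so a finite nonempty open set would be
  clopen.\<close>

lemma connected_infinite_openin_infinite:
  assumes "connected_space X" "Hausdorff_space X" "infinite (topspace X)" "openin X U" "U \<noteq> {}"
  shows "infinite U"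
proof
  assume "finite U"
  then have "closedin X U"
    using closedin_Hausdorff_finite[OF assms(2) openin_subset[OF assms(4)]] by simp
  then have "U = topspace X"
    using assms(1,4,5) unfolding connected_space_clopen_in by blast
  with \<open>finite U\<close> assms(3) show False by simp
qed

context weakly_ordered
begin

lemma asym: "\<lbrakk>x \<in> topspace X; y \<in> topspace X; lt x y\<rbrakk> \<Longrightarrow> \<not> lt y x"
  using trans irrefl by blast

text \<open>Otherwise the two open rays at \<open>a\<close> would separate \<open>C\<close>.\<close>

lemma connectedin_same_side:
  assumes "connectedin X C" "a \<in> topspace X" "a \<notin> C" "x \<in> C" "y \<in> C" "lt x a"
  shows "lt y a"
proof (rule ccontr)
  assume "\<not> lt y a"
  have C: "C \<subseteq> topspace X"
    using assms(1) by (rule connectedin_subset_topspace)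
  then have "lt a y"
    using \<open>\<not> lt y a\<close> assms total by blast
  show False
  proof (rule connectedinD[OF assms(1) open_below[OF assms(2)] open_above[OF assms(2)]])
    show "C \<subseteq> {y \<in> topspace X. lt y a} \<union> {y \<in> topspace X. lt a y}"
      using C total assms by blast
    show "{y \<in> topspace X. lt y a} \<inter> {y \<in> topspace X. lt a y} \<inter> C = {}"
      using asym assms by blast
    show "{y \<in> topspace X. lt y a} \<inter> C \<noteq> {}" "{y \<in> topspace X. lt a y} \<inter> C \<noteq> {}"
      using C assms \<open>lt a y\<close> by blast+
  qed
qed

lemma connectedin_above:
  assumes "connected_space X" "x \<in> topspace X"
  shows "connectedin X {y \<in> topspace X. lt x y}"
proof (cases "{y \<in> topspace X. lt x y} = {}")
  case False
  then obtain c where c: "c \<in> topspace X" "lt x c" by blast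
  \<comment> \<open>\<open>R y\<close> is the closed ray from \<open>y\<close>. For \<open>y\<close>
    above \<open>x\<close> and not above \<open>c\<close> these connected sets all contain
    \<open>c\<close>, and their union is the open ray above \<open>x\<close>.\<close>
  define R where "R y = insert y {z \<in> topspace X. lt y z}" for y
  have "connectedin X (R y)" if "y \<in> topspace X" for y
    unfolding R_def
    by (rule connectedin_insert_complement_piece[OF assms(1) that open_above[OF that] open_below[OF that]])
      (use that asym irrefl total in blast)+
  moreover have "\<Inter> (R ` {y \<in> topspace X. lt x y \<and> (y = c \<or> lt y c)}) \<noteq> {}"
    using c by (auto simp: R_def)
  ultimately have "connectedin X (\<Union> (R ` {y \<in> topspace X. lt x y \<and> (y = c \<or> lt y c)}))"
    by (intro connectedin_Union) auto
  moreover have "\<Union> (R ` {y \<in> topspace X. lt x y \<and> (y = c \<or> lt y c)}) = {y \<in> topspace X. lt x y}"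
    using c assms(2) by (auto simp: R_def intro: trans) (metis total)
  ultimately show ?thesis by simp
next
  case True
  then show ?thesis by (simp only: connectedin_empty)
qed

text \<open>With nothing between \<open>x\<close> and \<open>y\<close>, the ray above
  \<open>x\<close> and the ray below \<open>y\<close> would disconnect the space.\<close>

lemma dense:
  assumes "connected_space X" "x \<in> topspace X" "y \<in> topspace X" "lt x y"
  obtains z where "z \<in> topspace X" "lt x z" "lt z y"
proof -
  have "{z \<in> topspace X. lt x z} \<inter> {z \<in> topspace X. lt z y} \<noteq> {}"
  proof
    assume "{z \<in> topspace X. lt x z} \<inter> {z \<in> topspace X. lt z y} = {}"
    moreover have "topspace X \<subseteq> {z \<in> topspace X. lt x z} \<union> {z \<in> topspace X. lt z y}"
      using assms total trans by blast
    ultimately show False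
      using connected_spaceD[OF assms(1) open_above[OF assms(2)] open_below[OF assms(3)]] assms by blast
  qed
  then show thesis using that by blast
qed

text \<open>The points above \<open>a\<close> and outside \<open>U\<close> form a closed set. Its
  minimum, if it has one, is the bound \<open>b\<close>. Thus to the right of \<open>a\<close> the
  topology of \<open>X\<close> is no finer than the interval topology.\<close>

lemma right_neighbourhood:
  assumes least: "closed_sets_have_least X lt" and "openin X U" "a \<in> U"
  shows "(\<forall>z\<in>topspace X. lt a z \<longrightarrow> z \<in> U) \<or>
         (\<exists>b\<in>topspace X. lt a b \<and> (\<forall>z\<in>topspace X. lt a z \<longrightarrow> lt z b \<longrightarrow> z \<in> U))"
proof -
  have a: "a \<in> topspace X"
    using assms openin_subset by blast
  define S where "S = topspace X - (U \<union> {y \<in> topspace X. lt y a})"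
  have S: "S = {z \<in> topspace X. lt a z \<and> z \<notin> U}"
    using a assms(3) total asym unfolding S_def by blast
  show ?thesis
  proof (cases "S = {}")
    case False
    have "closedin X S"
      unfolding S_def by (intro closedin_diff closedin_topspace openin_Un assms open_below a)
    then obtain m where m: "m \<in> S" "\<And>s. s \<in> S \<Longrightarrow> s \<noteq> m \<Longrightarrow> lt m s"
      using closed_sets_have_leastE[OF least] False by metis
    have "m \<in> topspace X" "lt a m"
      using m S by auto
    moreover have "z \<in> U" if "z \<in> topspace X" "lt a z" "lt z m" for z
      using that m S asym irrefl by blast
    ultimately show ?thesis by blast
  qed (use S in blast)
qed

text \<open>Rays of \<open>lt\<close> are connected, so each lies on one side of its end point with
  respect to \<open>lt'\<close>. Hence whether \<open>lt'\<close> preserves or reverses a pair does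
  not change when one member of the pair is moved along such a ray.\<close>

lemma orders_agree:
  assumes conn: "connected_space X" and "weakly_ordered X lt'"
  shows "(\<forall>x\<in>topspace X. \<forall>y\<in>topspace X. lt x y \<longrightarrow> lt' x y) \<or>
         (\<forall>x\<in>topspace X. \<forall>y\<in>topspace X. lt x y \<longrightarrow> lt' y x)"
proof -
  interpret L: weakly_ordered X lt' by fact
  interpret C: weakly_ordered X "\<lambda>x y. lt y x"
    by (rule weakly_ordered_converse) (rule weakly_ordered_axioms)
  have left: "lt' x' y"
    if "lt x y" "lt x' y" "lt' x y" "x \<in> topspace X" "x' \<in> topspace X" "y \<in> topspace X" for x x' y
    by (rule L.connectedin_same_side[OF C.connectedin_above[OF conn that(6)]])
      (use that irrefl in auto)
  have right: "lt' x y'"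
    if "lt x y" "lt x y'" "lt' x y" "x \<in> topspace X" "y \<in> topspace X" "y' \<in> topspace X" for x y y'
  proof (rule ccontr)
    assume "\<not> lt' x y'"
    then have "lt' y' x"
      using that L.total irrefl by blast
    then have "lt' y x"
      using L.connectedin_same_side[OF connectedin_above[OF conn that(4)], of x y' y] that irrefl by auto
    then show False
      using that L.asym by blast
  qed
  have "lt' x' y'"
    if *: "lt x y" "lt x' y'" "lt' x y" "x \<in> topspace X" "y \<in> topspace X" "x' \<in> topspace X" "y' \<in> topspace X"
    for x y x' y'
  proof -
    \<comment> \<open>The smaller of \<open>x\<close> and \<open>x'\<close> lies below both
      \<open>y\<close> and \<open>y'\<close>, so the pair \<open>(x, y)\<close> can be moved to
      \<open>(m, y)\<close>, then \<open>(m, y')\<close>, then \<open>(x', y')\<close>, one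
      coordinate at a time.\<close>
    define m where "m = (if lt x' x then x' else x)"
    have m: "m \<in> topspace X" "lt m y" "lt m y'"
      using * total[of x x'] trans[of x' x y] trans[of x x' y'] unfolding m_def by auto
    have "lt' m y"
      using left[of x y m] * m by blast
    then have "lt' m y'"
      using right[of m y y'] * m by blast
    then show ?thesis
      using left[of m y' x'] * m by blast
  qed
  then show ?thesis
    using L.total irrefl by metis
qed

end

section \<open>Orderability and compactness from minima and maxima of closed sets\<close>

lemma weakly_ordered_min_max_imp_orderable:
  assumes "weakly_ordered X lt" "closed_sets_have_least X lt"
    and "closed_sets_have_least X (\<lambda>x y. lt y x)"
  shows "orderable_space X"
proof -
  interpret weakly_ordered X lt by fact
  interpret C: weakly_ordered X "\<lambda>x y. lt y x"
    by (rule weakly_ordered_converse) fact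
  define r where "r = {(x, y). x \<in> topspace X \<and> y \<in> topspace X \<and> (x = y \<or> lt x y)}"
  define T where "T = open_interval_topology (topspace X) r"
  have lin: "linear_order_on (topspace X) r"
    unfolding order_on_defs r_def refl_on_def trans_def antisym_def total_on_def
    using trans asym total by blast
  have rays: "underS r x = {y \<in> topspace X. lt y x}" "aboveS r x = {y \<in> topspace X. lt x y}"
    if "x \<in> topspace X" for x
    using that irrefl unfolding underS_def aboveS_def r_def by auto
  have T_top: "openin T (topspace X)"
    and T_below: "openin T {y \<in> topspace X. lt y x}"
    and T_above: "openin T {y \<in> topspace X. lt x y}" if "x \<in> topspace X" for x
    unfolding T_def open_interval_topology_def rays[OF that, symmetric]
    using that by (auto intro: topology_generated_by_Basis)
  have "openin X U" if "openin T U" for U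
    using that unfolding T_def open_interval_topology_def openin_topology_generated_by_iff
  proof induction
    case (Basis s)
    then show ?case
      using open_below open_above by (auto simp: rays)
  qed auto
  moreover have "openin T U" if U: "openin X U" for U
  proof (subst openin_subopen, intro ballI)
    fix a assume a: "a \<in> U"
    then have aX: "a \<in> topspace X"
      using U openin_subset by blast
    \<comment> \<open>\<open>P\<close> can be taken as the whole carrier or the ray below the bound
      \<open>b\<close> of \<open>right_neighbourhood\<close>; \<open>Q\<close> is its mirror image,
      which rests on maxima. Their intersection is a neighbourhood of \<open>a\<close> in the
      interval topology.\<close>
    obtain P where P: "openin T P" "a \<in> P" "\<And>z. z \<in> P \<Longrightarrow> lt a z \<Longrightarrow> z \<in> U" "P \<subseteq> topspace X"
      using right_neighbourhood[OF assms(2) U a] aX T_top T_below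
      by (smt (verit, best) mem_Collect_eq subsetI)
    obtain Q where Q: "openin T Q" "a \<in> Q" "\<And>z. z \<in> Q \<Longrightarrow> lt z a \<Longrightarrow> z \<in> U"
      using C.right_neighbourhood[OF assms(3) U a] aX T_top T_above
      by (smt (verit, best) mem_Collect_eq subsetI)
    have "P \<inter> Q \<subseteq> U"
      using P Q aX a total by blast
    then show "\<exists>V. openin T V \<and> a \<in> V \<and> V \<subseteq> U"
      using P Q by (intro exI[of _ "P \<inter> Q"]) auto
  qed
  ultimately have "X = T"
    by (auto simp: topology_eq)
  then show ?thesis
    using lin unfolding orderable_space_def T_def by blast
qed

text \<open>Induction along the order: the initial segments without a finite subcover have no least
  end point, hence there are none, and the segment up to the maximum is the whole space.\<close>

lemma weakly_ordered_min_max_imp_compact: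
  assumes "weakly_ordered X lt" "closed_sets_have_least X lt"
    and "closed_sets_have_least X (\<lambda>x y. lt y x)"
  shows "compact_space X"
  unfolding compact_space_alt
proof (intro allI impI)
  fix \<U>
  assume "(\<forall>U\<in>\<U>. openin X U) \<and> topspace X \<subseteq> \<Union>\<U>"
  then have op: "\<forall>U\<in>\<U>. openin X U" and cov: "topspace X \<subseteq> \<Union>\<U>"
    by simp_all
  interpret weakly_ordered X lt by fact
  interpret C: weakly_ordered X "\<lambda>x y. lt y x"
    by (rule weakly_ordered_converse) fact
  define fc where "fc S \<longleftrightarrow> (\<exists>\<F>. finite \<F> \<and> \<F> \<subseteq> \<U> \<and> S \<subseteq> \<Union>\<F>)" for S
  have fc_Un: "fc (S \<union> V)" if S: "fc S" and V: "V \<in> \<U>" for S V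
  proof -
    obtain \<F> where "finite \<F>" "\<F> \<subseteq> \<U>" "S \<subseteq> \<Union>\<F>"
      using S unfolding fc_def by blast
    then have "finite (insert V \<F>) \<and> insert V \<F> \<subseteq> \<U> \<and> S \<union> V \<subseteq> \<Union>(insert V \<F>)"
      using V by auto
    then show ?thesis
      unfolding fc_def by (rule exI)
  qed
  have fc_sub: "fc S" if "fc S'" "S \<subseteq> S'" for S S'
    using that(1) order_trans[OF that(2)] unfolding fc_def by metis
  define I where "I x = {y \<in> topspace X. y = x \<or> lt y x}" for x
  define D where "D = {x \<in> topspace X. \<not> fc (I x)}"
  \<comment> \<open>If \<open>I x\<close> is finitely covered, one further member of the cover,
    chosen around \<open>x\<close>, also takes care of the points slightly to the right of
    \<open>x\<close>. So all segments ending near \<open>x\<close> are finitely covered.\<close>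
  have "openin X (topspace X - D)"
  proof (subst openin_subopen, intro ballI)
    fix x assume x: "x \<in> topspace X - D"
    then have fx: "fc (I x)" and xX: "x \<in> topspace X"
      by (auto simp: D_def)
    then obtain U where U: "U \<in> \<U>" "x \<in> U"
      using cov by blast
    obtain P where P: "openin X P" "x \<in> P" "P \<subseteq> topspace X"
      "\<And>y z. y \<in> P \<Longrightarrow> z \<in> topspace X \<Longrightarrow> lt x z \<Longrightarrow> z = y \<or> lt z y \<Longrightarrow> z \<in> U"
    proof -
      consider "\<forall>z\<in>topspace X. lt x z \<longrightarrow> z \<in> U"
        | b where "b\<in>topspace X" "lt x b" "\<forall>z\<in>topspace X. lt x z \<longrightarrow> lt z b \<longrightarrow> z \<in> U"
        using right_neighbourhood[OF assms(2), of U x] U op by blast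
      then show thesis
      proof cases
        case 1
        then show thesis
          using that[of "topspace X"] xX by blast
      next
        case 2
        then show thesis
          using that[of "{y \<in> topspace X. lt y b}"] xX open_below trans by blast
      qed
    qed
    have "I y \<subseteq> I x \<union> U" if "y \<in> P" for y
      using P(4)[OF that] P(3) that total xX unfolding I_def by blast
    then have "P \<subseteq> topspace X - D"
      using fc_sub[OF fc_Un[OF fx U(1)]] P(3) unfolding D_def by blast
    then show "\<exists>P. openin X P \<and> x \<in> P \<and> P \<subseteq> topspace X - D"
      using P by blast
  qed
  then have "closedin X D"
    by (auto simp: closedin_def D_def)
  \<comment> \<open>At the least element \<open>d\<close> of \<open>D\<close>, a member of the cover
    around \<open>d\<close> contains everything below \<open>d\<close>, or everything between some
    \<open>b\<close> and \<open>d\<close>. In the second case \<open>I b\<close> is finitely covered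
    by minimality.\<close>
  have "D = {}"
  proof (rule ccontr)
    assume "D \<noteq> {}"
    then obtain d where d: "d \<in> D" "\<And>s. s \<in> D \<Longrightarrow> s \<noteq> d \<Longrightarrow> lt d s"
      using closed_sets_have_leastE[OF assms(2) \<open>closedin X D\<close>] by metis
    then have dX: "d \<in> topspace X" and nfc: "\<not> fc (I d)"
      by (auto simp: D_def)
    then obtain U where U: "U \<in> \<U>" "d \<in> U"
      using cov by blast
    consider "\<forall>z\<in>topspace X. lt z d \<longrightarrow> z \<in> U"
      | b where "b\<in>topspace X" "lt b d" "\<forall>z\<in>topspace X. lt z d \<longrightarrow> lt b z \<longrightarrow> z \<in> U"
      using C.right_neighbourhood[OF assms(3), of U d] U op by blast
    then show False
    proof cases
      case 1
      then have "I d \<subseteq> {} \<union> U"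
        using U by (auto simp: I_def)
      moreover have "fc {}"
        by (auto simp: fc_def)
      ultimately show False
        using fc_sub[OF fc_Un[OF _ U(1)]] nfc by blast
    next
      case 2
      then have "b \<notin> D"
        using d(2)[of b] asym[of b d] dX irrefl by blast
      then have "fc (I b)"
        using 2 by (auto simp: D_def)
      moreover have "I d \<subseteq> I b \<union> U"
        using 2 U total unfolding I_def by blast
      ultimately show False
        using fc_sub[OF fc_Un[OF _ U(1)]] nfc by blast
    qed
  qed
  show "\<exists>\<F>. finite \<F> \<and> \<F> \<subseteq> \<U> \<and> topspace X \<subseteq> \<Union>\<F>"
  proof (cases "topspace X = {}")
    case False
    then obtain m where m: "m \<in> topspace X" "\<And>s. s \<in> topspace X \<Longrightarrow> s \<noteq> m \<Longrightarrow> lt s m"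
      using closed_sets_have_leastE[OF assms(3) closedin_topspace] by metis
    then have "topspace X \<subseteq> I m"
      by (auto simp: I_def)
    moreover have "fc (I m)"
      using m \<open>D = {}\<close> by (auto simp: D_def)
    ultimately have "fc (topspace X)"
      by (rule fc_sub[rotated])
    then show ?thesis
      unfolding fc_def .
  qed (auto intro: exI[of _ "{}"])
qed

section \<open>Continuous selections on connected spaces\<close>

lemma (in weakly_ordered) finite_has_least:
  assumes "finite F" "F \<noteq> {}" "F \<subseteq> topspace X"
  shows "\<exists>m\<in>F. \<forall>s\<in>F. s \<noteq> m \<longrightarrow> lt m s"
  using assms
proof (induction F rule: finite_ne_induct)
  case (insert x F)
  then obtain m where m: "m \<in> F" "\<And>s. s \<in> F \<Longrightarrow> s \<noteq> m \<Longrightarrow> lt m s"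
    by auto
  have mx: "m \<in> topspace X" "x \<in> topspace X" "m \<noteq> x"
    using insert.prems insert.hyps m(1) by auto
  show ?case
  proof (cases "lt x m")
    case True
    have "lt x s" if "s \<in> F" for s
      using m(2)[OF that] trans[of x m s] True mx insert.prems that by auto
    then show ?thesis by auto
  next
    case False
    then have "lt m x"
      using total mx by metis
    then show ?thesis
      using m by auto
  qed
qed simp

text \<open>If \<open>\<V>\<close> covers \<open>A\<close>, then \<open>insert t A\<close> lies in
  the basic set of \<open>\<V>\<close> exactly when \<open>t\<close> lies in the union of
  \<open>\<V>\<close> and in each member that misses \<open>A\<close>: a finite intersection of open
  sets.\<close>

lemma continuous_map_insert_vietoris:
  assumes "t1_space Y" "finite A" "A \<subseteq> topspace Y"
  shows "continuous_map Y (vietoris_topology Y) (\<lambda>t. insert t A)"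
  unfolding vietoris_topology_def
proof (rule continuous_on_generated_topo)
  have ins: "insert t A \<in> nonempty_closed_sets Y" if "t \<in> topspace Y" for t
    using assms that by (simp add: nonempty_closed_sets_def t1_space_closedin_finite)
  then show "(\<lambda>t. insert t A) ` topspace Y
      \<subseteq> \<Union>{vietoris_basic Y \<V> |\<V>. finite \<V> \<and> (\<forall>V\<in>\<V>. openin Y V)}"
    using topspace_vietoris_topology[of Y]
    unfolding vietoris_topology_def topology_generated_by_topspace by auto
  fix U
  assume "U \<in> {vietoris_basic Y \<V> |\<V>. finite \<V> \<and> (\<forall>V\<in>\<V>. openin Y V)}"
  then obtain \<V> where U: "U = vietoris_basic Y \<V>" and fin: "finite \<V>"
    and op: "\<And>V. V \<in> \<V> \<Longrightarrow> openin Y V"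
    by auto
  show "openin Y ((\<lambda>t. insert t A) -` U \<inter> topspace Y)"
  proof (cases "A \<subseteq> \<Union>\<V>")
    case True
    have opU: "openin Y (\<Union>\<V>)"
      using op by (rule openin_Union)
    have "(\<lambda>t. insert t A) -` U \<inter> topspace Y = \<Inter>(insert (\<Union>\<V>) {V \<in> \<V>. A \<inter> V = {}})"
    proof (intro set_eqI iffI)
      fix t assume "t \<in> (\<lambda>t. insert t A) -` U \<inter> topspace Y"
      then show "t \<in> \<Inter>(insert (\<Union>\<V>) {V \<in> \<V>. A \<inter> V = {}})"
        by (auto simp: U vietoris_basic_def)
    next
      fix t assume t: "t \<in> \<Inter>(insert (\<Union>\<V>) {V \<in> \<V>. A \<inter> V = {}})"
      then have tY: "t \<in> topspace Y"
        using openin_subset[OF opU] by auto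
      have "insert t A \<inter> V \<noteq> {}" if "V \<in> \<V>" for V
        using t that by (cases "A \<inter> V = {}") auto
      then show "t \<in> (\<lambda>t. insert t A) -` U \<inter> topspace Y"
        using t True tY ins[OF tY] by (simp add: U vietoris_basic_def)
    qed
    moreover have "openin Y (\<Inter>(insert (\<Union>\<V>) {V \<in> \<V>. A \<inter> V = {}}))"
      by (rule openin_Inter) (use fin op opU in auto)
    ultimately show ?thesis by simp
  next
    case False
    then have "(\<lambda>t. insert t A) -` U \<inter> topspace Y = {}"
      by (auto simp: U vietoris_basic_def)
    then show ?thesis by simp
  qed
qed

text \<open>For a basic set, one point of \<open>S\<close> from each of its finitely many members
  suffices. This passes from arbitrary closed sets to finite ones.\<close>

lemma vietoris_finite_approximation:
  assumes "openin (vietoris_topology Z) \<O>" "S \<in> \<O>"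
  shows "\<exists>F. finite F \<and> F \<subseteq> S \<and>
           (\<forall>T \<in> nonempty_closed_sets Z. F \<subseteq> T \<longrightarrow> T \<subseteq> S \<longrightarrow> T \<in> \<O>)"
  using assms unfolding vietoris_topology_def openin_topology_generated_by_iff
proof (induction rule: generate_topology_on.induct)
  case (Int a b)
  then obtain F G where
    "finite F \<and> F \<subseteq> S \<and> (\<forall>T \<in> nonempty_closed_sets Z. F \<subseteq> T \<longrightarrow> T \<subseteq> S \<longrightarrow> T \<in> a)"
    "finite G \<and> G \<subseteq> S \<and> (\<forall>T \<in> nonempty_closed_sets Z. G \<subseteq> T \<longrightarrow> T \<subseteq> S \<longrightarrow> T \<in> b)"
    by auto
  then show ?case
    by (intro exI[of _ "F \<union> G"]) simp
next
  case (UN K)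
  then obtain k where k: "k \<in> K" "S \<in> k"
    by auto
  then obtain F where
    "finite F \<and> F \<subseteq> S \<and> (\<forall>T \<in> nonempty_closed_sets Z. F \<subseteq> T \<longrightarrow> T \<subseteq> S \<longrightarrow> T \<in> k)"
    using UN.IH by metis
  then show ?case
    using k(1) by (intro exI[of _ F]) auto
next
  case (Basis s)
  then obtain \<V> where s: "s = vietoris_basic Z \<V>" and fin: "finite \<V>"
    by auto
  then have S: "S \<subseteq> \<Union>\<V>" "\<forall>V\<in>\<V>. \<exists>x. x \<in> S \<inter> V"
    using Basis.prems by (auto simp: vietoris_basic_def)
  then obtain p where p: "\<And>V. V \<in> \<V> \<Longrightarrow> p V \<in> S \<inter> V"
    by metis
  have "T \<in> s" if T: "T \<in> nonempty_closed_sets Z" "p ` \<V> \<subseteq> T" "T \<subseteq> S" for T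
  proof -
    have "T \<inter> V \<noteq> {}" if "V \<in> \<V>" for V
      using p[OF that] T(2) that by auto
    moreover have "T \<subseteq> \<Union>\<V>"
      using T(3) S(1) by (rule order_trans)
    ultimately show ?thesis
      using T(1) by (simp add: s vietoris_basic_def)
  qed
  moreover have "p ` \<V> \<subseteq> S"
    using p by auto
  ultimately show ?case
    using fin by (intro exI[of _ "p ` \<V>"]) simp
qed simp

text \<open>The order is read off from two-point sets: the selected point is the smaller one.
  Connectedness yields transitivity and shows that \<open>f\<close> picks the minimum of each finite
  set; continuity of \<open>f\<close> extends this to closed sets.\<close>

lemma continuous_selection_imp_weakly_ordered:
  assumes conn: "connected_space Y" and haus: "Hausdorff_space Y" and sel: "continuous_selection Y f"
  obtains lt where "weakly_ordered Y lt" "closed_sets_have_least Y lt"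
proof -
  have t1: "t1_space Y"
    using haus by (rule Hausdorff_imp_t1_space)
  have fin_closed: "A \<in> nonempty_closed_sets Y" if "finite A" "A \<noteq> {}" "A \<subseteq> topspace Y" for A
    using t1 that by (simp add: nonempty_closed_sets_def t1_space_closedin_finite)
  have mem: "f S \<in> S" if "S \<in> nonempty_closed_sets Y" for S
    using sel that by (simp add: continuous_selection_def)
  have fcont: "continuous_map (vietoris_topology Y) Y f"
    using sel by (simp add: continuous_selection_def)
  have pre: "openin Y {t \<in> topspace Y. f (insert t A) \<in> U}"
    if "finite A" "A \<subseteq> topspace Y" "openin Y U" for A U
  proof -
    have "continuous_map Y Y (\<lambda>t. f (insert t A))"
      using continuous_map_compose[OF continuous_map_insert_vietoris[OF t1 that(1,2)] fcont]
      by (simp add: comp_def)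
    then show ?thesis
      using that(3) by (rule openin_continuous_map_preimage)
  qed
  have ne: "openin Y {t \<in> topspace Y. t \<noteq> a}" if "a \<in> topspace Y" for a
  proof -
    have "{t \<in> topspace Y. t \<noteq> a} = topspace Y - {a}"
      by auto
    then show ?thesis
      using openin_diff[OF openin_topspace closedin_t1_singleton[OF t1 that]] by simp
  qed
  \<comment> \<open>Together with \<open>eq_open\<close>: for \<open>t\<close> away from
    \<open>a\<close>, both selecting \<open>a\<close> from \<open>insert t A\<close> and not
    selecting it are open conditions on \<open>t\<close>. So the answer is constant on connected
    sets avoiding \<open>a\<close>.\<close>
  have neq_open: "openin Y {t \<in> topspace Y. t \<noteq> a \<and> f (insert t A) \<noteq> a}"
    if A: "finite A" "A \<subseteq> topspace Y" "a \<in> A" for A a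
  proof -
    have aY: "a \<in> topspace Y"
      using A by auto
    have "f (insert t A) \<in> topspace Y" if "t \<in> topspace Y" for t
      using mem[OF fin_closed, of "insert t A"] A that by auto
    then have "{t \<in> topspace Y. t \<noteq> a \<and> f (insert t A) \<noteq> a} =
        {t \<in> topspace Y. t \<noteq> a} \<inter> {t \<in> topspace Y. f (insert t A) \<in> {t \<in> topspace Y. t \<noteq> a}}"
      by auto
    then show ?thesis
      using openin_Int[OF ne[OF aY] pre[OF A(1,2) ne[OF aY]]] by simp
  qed
  have eq_open: "openin Y {t \<in> topspace Y. t \<noteq> a \<and> f (insert t A) = a}"
    if A: "finite A" "A \<subseteq> topspace Y" "a \<in> A" for A a
  proof (subst openin_subopen, intro ballI)
    fix t assume t: "t \<in> {t \<in> topspace Y. t \<noteq> a \<and> f (insert t A) = a}"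
    then have "a \<in> topspace Y \<and> t \<in> topspace Y \<and> a \<noteq> t"
      using A by auto
    then obtain U V where UV: "openin Y U" "openin Y V" "a \<in> U" "t \<in> V" "disjnt U V"
      using haus[unfolded Hausdorff_space_def, rule_format, of a t] by auto
    have "closedin Y (A - {a})"
      using t1 A by (auto simp: t1_space_closedin_finite)
    then have U': "openin Y (U - (A - {a}))"
      using UV by (intro openin_diff)
    \<comment> \<open>On \<open>W\<close> the selected point is near \<open>a\<close>, hence neither
      the moving point, which stays in \<open>V\<close>, nor another point of \<open>A\<close>. Only
      \<open>a\<close> remains.\<close>
    define W where "W = {s \<in> topspace Y. f (insert s A) \<in> U - (A - {a})} \<inter> V"
    have "openin Y W"
      unfolding W_def using UV pre[OF A(1,2) U'] by (intro openin_Int)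
    moreover have "t \<in> W"
      using t UV by (simp add: W_def)
    moreover have "W \<subseteq> {t \<in> topspace Y. t \<noteq> a \<and> f (insert t A) = a}"
    proof
      fix s assume s: "s \<in> W"
      then have sY: "s \<in> topspace Y" and "s \<noteq> a" and fs: "f (insert s A) \<in> U - (A - {a})"
        using UV by (auto simp: W_def disjnt_iff)
      have "f (insert s A) \<in> insert s A"
        using sY A by (intro mem fin_closed) auto
      moreover have "s \<notin> U"
        using s UV by (auto simp: W_def disjnt_iff)
      ultimately have "f (insert s A) = a"
        using fs by auto
      then show "s \<in> {t \<in> topspace Y. t \<noteq> a \<and> f (insert t A) = a}"
        using sY \<open>s \<noteq> a\<close> by simp
    qed
    ultimately show "\<exists>T. openin Y T \<and> t \<in> T \<and> T \<subseteq> {t \<in> topspace Y. t \<noteq> a \<and> f (insert t A) = a}"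
      by (intro exI[of _ W] conjI)
  qed
  define lt where "lt x y \<longleftrightarrow> x \<noteq> y \<and> f {x, y} = x" for x y
  have pair: "f {x, y} = x \<or> f {x, y} = y" if "x \<in> topspace Y" "y \<in> topspace Y" for x y
    using mem[OF fin_closed, of "{x, y}"] that by auto
  have tot: "lt x y \<or> lt y x" if "x \<in> topspace Y" "y \<in> topspace Y" "x \<noteq> y" for x y
    using pair[OF that(1,2)] that(3) by (auto simp: lt_def insert_commute)
  have asym: "\<not> lt y x" if "lt x y" for x y
    using that by (auto simp: lt_def insert_commute)
  have above: "openin Y {y \<in> topspace Y. lt x y}" if "x \<in> topspace Y" for x
  proof -
    have "{y \<in> topspace Y. lt x y} = {t \<in> topspace Y. t \<noteq> x \<and> f (insert t {x}) = x}"
      by (auto simp: lt_def insert_commute)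
    then show ?thesis
      using eq_open[of "{x}" x] that by simp
  qed
  have below: "openin Y {y \<in> topspace Y. lt y x}" if "x \<in> topspace Y" for x
  proof -
    have "{y \<in> topspace Y. lt y x} = {t \<in> topspace Y. t \<noteq> x \<and> f (insert t {x}) \<noteq> x}"
      using pair that by (auto simp: lt_def)
    then show ?thesis
      using neq_open[of "{x}" x] that by simp
  qed
  have wo: "weakly_ordered Y lt"
  proof unfold_locales
    fix x y z
    assume *: "x \<in> topspace Y" "y \<in> topspace Y" "z \<in> topspace Y" "lt x y" "lt y z"
    \<comment> \<open>The closed ray below \<open>y\<close> is connected and misses
      \<open>z\<close>. As \<open>y\<close> is below \<open>z\<close>, so is
      \<open>x\<close>.\<close>
    let ?L = "insert y {t \<in> topspace Y. lt t y}"
    have L: "connectedin Y ?L"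
      by (rule connectedin_insert_complement_piece[OF conn *(2) below[OF *(2)] above[OF *(2)]])
        (use asym tot *(2) in \<open>auto simp: lt_def\<close>)
    show "lt x z"
    proof (rule ccontr)
      assume "\<not> lt x z"
      then have "lt z x"
        using tot[OF *(1,3)] asym *(4,5) by auto
      show False
      proof (rule connectedinD[OF L below[OF *(3)] above[OF *(3)]])
        show "?L \<subseteq> {t \<in> topspace Y. lt t z} \<union> {t \<in> topspace Y. lt z t}"
          using tot[OF _ *(3)] asym[OF *(5)] *(2,5) by auto
        show "{t \<in> topspace Y. lt t z} \<inter> {t \<in> topspace Y. lt z t} \<inter> ?L = {}"
          using asym by auto
        show "{t \<in> topspace Y. lt t z} \<inter> ?L \<noteq> {}" "{t \<in> topspace Y. lt z t} \<inter> ?L \<noteq> {}"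
          using * \<open>lt z x\<close> by auto
      qed
    qed
  next
    show "\<not> lt x x" for x
      by (simp add: lt_def)
  qed (fact tot above below)+
  then interpret weakly_ordered Y lt .
  have finite_sel: "f (insert a F) = a"
    if "finite F" "F \<subseteq> {t \<in> topspace Y. lt a t}" and a: "a \<in> topspace Y" for a F
    using that(1,2)
  proof (induction F)
    case empty
    then show ?case
      using mem[OF fin_closed, of "{a}"] a by auto
  next
    case (insert u G)
    show ?case
    proof (cases "G = {}")
      case True
      then show ?thesis
        using insert.prems by (simp add: lt_def)
    next
      case False
      let ?A = "insert a G" and ?R = "{t \<in> topspace Y. lt a t}"
      have A: "finite ?A" "?A \<subseteq> topspace Y" "a \<in> ?A"
        using insert.prems insert.hyps a by auto
      obtain v where v: "v \<in> G"
        using False by auto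
      \<comment> \<open>Slide \<open>u\<close> inside the connected ray above \<open>a\<close> until it merges with a point of \<open>G\<close>:
        whether the selected point is \<open>a\<close> cannot change on the way.\<close>
      show ?thesis
      proof (rule ccontr)
        assume "f (insert a (insert u G)) \<noteq> a"
        then have u: "f (insert u ?A) \<noteq> a"
          by (simp add: insert_commute)
        have "f ?A = a"
          using insert by simp
        then have v': "f (insert v ?A) = a"
          using v by (simp add: insert_absorb)
        show False
        proof (rule connectedinD[OF connectedin_above[OF conn a] eq_open[OF A] neq_open[OF A]])
          show "?R \<subseteq> {t \<in> topspace Y. t \<noteq> a \<and> f (insert t ?A) = a} \<union>
              {t \<in> topspace Y. t \<noteq> a \<and> f (insert t ?A) \<noteq> a}"
            using irrefl a by auto
          show "{t \<in> topspace Y. t \<noteq> a \<and> f (insert t ?A) = a} \<inter>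
              {t \<in> topspace Y. t \<noteq> a \<and> f (insert t ?A) \<noteq> a} \<inter> ?R = {}"
            by auto
          have "v \<in> {t \<in> topspace Y. t \<noteq> a \<and> f (insert t ?A) = a} \<inter> ?R"
            using v v' insert.prems irrefl[OF a] by auto
          then show "{t \<in> topspace Y. t \<noteq> a \<and> f (insert t ?A) = a} \<inter> ?R \<noteq> {}"
            by (metis empty_iff)
          have "u \<in> {t \<in> topspace Y. t \<noteq> a \<and> f (insert t ?A) \<noteq> a} \<inter> ?R"
            using u insert.prems irrefl[OF a] by auto
          then show "{t \<in> topspace Y. t \<noteq> a \<and> f (insert t ?A) \<noteq> a} \<inter> ?R \<noteq> {}"
            by (metis empty_iff)
        qed
      qed
    qed
  qed
  have "\<exists>m\<in>S. \<forall>s\<in>S. s \<noteq> m \<longrightarrow> lt m s" if S: "closedin Y S" "S \<noteq> {}" for S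
  proof (intro bexI ballI impI)
    have SF: "S \<in> nonempty_closed_sets Y"
      using S by (simp add: nonempty_closed_sets_def)
    show fS: "f S \<in> S"
      using mem[OF SF] .
    have SY: "S \<subseteq> topspace Y"
      using S(1) by (rule closedin_subset)
    fix b assume b: "b \<in> S" "b \<noteq> f S"
    have bY: "b \<in> topspace Y" and fY: "f S \<in> topspace Y"
      using b fS SY by auto
    show "lt (f S) b"
    proof (rule ccontr)
      assume "\<not> lt (f S) b"
      then have "lt b (f S)"
        using tot[OF bY fY b(2)] by simp
      \<comment> \<open>If \<open>f S\<close> were above \<open>b\<close>, the same would hold for a
        finite subset of \<open>S\<close> containing \<open>b\<close>. But there \<open>f\<close>
        picks the minimum, which is not above \<open>b\<close>.\<close>
      define \<O> where "\<O> = {T \<in> nonempty_closed_sets Y. f T \<in> {y \<in> topspace Y. lt b y}}"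
      have "openin (vietoris_topology Y) \<O>"
        using openin_continuous_map_preimage[OF fcont above[OF bY]] by (simp add: \<O>_def)
      moreover have "S \<in> \<O>"
        using SF fY \<open>lt b (f S)\<close> by (simp add: \<O>_def)
      ultimately have "\<exists>F. finite F \<and> F \<subseteq> S \<and>
           (\<forall>T \<in> nonempty_closed_sets Y. F \<subseteq> T \<longrightarrow> T \<subseteq> S \<longrightarrow> T \<in> \<O>)"
        by (rule vietoris_finite_approximation)
      then obtain F where F: "finite F" "F \<subseteq> S"
        "\<And>T. T \<in> nonempty_closed_sets Y \<Longrightarrow> F \<subseteq> T \<Longrightarrow> T \<subseteq> S \<Longrightarrow> T \<in> \<O>"
        by auto
      have bF: "finite (insert b F)" "insert b F \<subseteq> topspace Y"
        using F b SY by auto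
      then have "insert b F \<in> \<O>"
        using F b by (intro F(3) fin_closed) auto
      then have bf: "lt b (f (insert b F))"
        by (simp add: \<O>_def)
      obtain m where m: "m \<in> insert b F" "\<And>s. s \<in> insert b F \<Longrightarrow> s \<noteq> m \<Longrightarrow> lt m s"
        using finite_has_least[OF bF(1) _ bF(2)] by auto
      have "f (insert m (insert b F - {m})) = m"
        using bF m by (intro finite_sel) auto
      then have "lt b m"
        using bf m(1) by (simp add: insert_absorb)
      then show False
        using m asym[of b m] irrefl[OF bY] bF(2) bY by auto
    qed
  qed
  then have "closed_sets_have_least Y lt"
    by (simp add: closed_sets_have_least_def)
  with wo show thesis
    by (rule that)
qed

section \<open>Removing a noncut point\<close>

text \<open>Adjoining \<open>p\<close> as last point keeps minima: unless \<open>S\<close> is just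
  \<open>{p}\<close>, the minimum of \<open>S - {p}\<close> is also below \<open>p\<close>.\<close>

lemma closed_sets_have_least_glue:
  assumes least: "closed_sets_have_least (subtopology X (topspace X - {p})) lt"
    and "\<And>x y. x \<in> topspace X - {p} \<Longrightarrow> y \<in> topspace X - {p} \<Longrightarrow> lt x y \<Longrightarrow> lt' x y"
    and "\<And>x. x \<in> topspace X - {p} \<Longrightarrow> lt' x p"
  shows "closed_sets_have_least X lt'"
  unfolding closed_sets_have_least_def
proof (intro allI impI)
  fix S assume S: "closedin X S" "S \<noteq> {}"
  have SX: "S \<subseteq> topspace X"
    using S(1) by (rule closedin_subset)
  show "\<exists>m\<in>S. \<forall>s\<in>S. s \<noteq> m \<longrightarrow> lt' m s"
  proof (cases "S \<subseteq> {p}")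
    case True
    then show ?thesis
      using S(2) by auto
  next
    case False
    then have ne: "(topspace X - {p}) \<inter> S \<noteq> {}"
      using SX by auto
    have cl: "closedin (subtopology X (topspace X - {p})) ((topspace X - {p}) \<inter> S)"
      using S(1) by (rule closedin_subtopology_Int_closed)
    obtain m where m: "m \<in> (topspace X - {p}) \<inter> S"
      "\<And>s. s \<in> (topspace X - {p}) \<inter> S \<Longrightarrow> s \<noteq> m \<Longrightarrow> lt m s"
      using closed_sets_have_leastE[OF least cl ne] by metis
    have "lt' m s" if "s \<in> S" "s \<noteq> m" for s
    proof (cases "s = p")
      case True
      then show ?thesis
        using assms(3) m(1) by auto
    next
      case False
      then show ?thesis
        using that SX m by (intro assms(2)) auto
    qed
    then show ?thesis
      using m(1) by auto
  qed
qed

section \<open>The ordered complement of one noncut point\<close>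

locale min_ordered_complement =
  fixes X :: "'a topology" and p :: 'a and lt :: "'a \<Rightarrow> 'a \<Rightarrow> bool" and q :: 'a
  assumes connected: "connected_space X" and Hausdorff: "Hausdorff_space X"
    and inf: "infinite (topspace X)"
    and noncut: "noncut_point X p"
    and ordered: "weakly_ordered (subtopology X (topspace X - {p})) lt"
    and least: "closed_sets_have_least (subtopology X (topspace X - {p})) lt"
    and q: "q \<in> topspace X - {p}"
    and q_least: "x \<in> topspace X - {p} \<Longrightarrow> x \<noteq> q \<Longrightarrow> lt q x"
begin

abbreviation "Y \<equiv> subtopology X (topspace X - {p})"
abbreviation "W \<equiv> topspace X - {p, q}"

lemma topspace_Y: "topspace Y = topspace X - {p}"
  by auto

text \<open>The rewrite makes the inherited facts speak of \<open>topspace X - {p}\<close>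
  directly.\<close>

sublocale Y: weakly_ordered Y lt
  rewrites "topspace (subtopology X (topspace X - {p})) = topspace X - {p}"
  by (fact ordered topspace_Y)+

lemma p: "p \<in> topspace X" and connected_Y: "connected_space Y"
  using noncut by (auto simp: noncut_point_def connectedin_def)

lemma open_delete: "openin X (topspace X - {x})"
  using closedin_Hausdorff_singleton[OF Hausdorff, of x]
  by (cases "x \<in> topspace X") (auto intro: openin_diff)

lemma openin_Y_imp: "openin Y U \<Longrightarrow> openin X U"
  by (rule openin_trans_full[OF _ open_delete])

lemma W_nonempty: "W \<noteq> {}"
  using inf by (metis Diff_eq_empty_iff finite.emptyI finite.insertI finite_subset)

lemma W_eq: "W = {y \<in> topspace X - {p}. lt q y}"
  using Y.irrefl[OF q] q_least by auto

lemma connectedin_W: "connectedin X W"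
  using Y.connectedin_above[OF connected_Y q] unfolding W_eq connectedin_subtopology by simp

lemma infinite_open: "openin X U \<Longrightarrow> U \<noteq> {} \<Longrightarrow> infinite U"
  using connected_infinite_openin_infinite[OF connected Hausdorff inf] .

text \<open>Nonempty open sets are infinite, so no neighbourhood of \<open>x\<close> meets
  \<open>U\<close> in \<open>x\<close> alone.\<close>

lemma in_closure_of_open_delete:
  assumes "openin X U" "x \<in> U"
  shows "x \<in> X closure_of (U - {x})"
  unfolding in_closure_of
proof (intro conjI allI impI)
  show "x \<in> topspace X"
    using assms openin_subset by auto
  fix T assume T: "x \<in> T \<and> openin X T"
  then have "openin X (U \<inter> T)" "U \<inter> T \<noteq> {}"
    using assms by auto
  then have "\<not> U \<inter> T \<subseteq> {x}"
    using infinite_open finite_subset by blast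
  then show "\<exists>y. y \<in> U - {x} \<and> y \<in> T"
    by auto
qed

text \<open>\<open>W\<close> is connected, being the open ray above \<open>q\<close>, and
  \<open>p\<close> is in its closure. Hence adding \<open>p\<close> back keeps it connected, and the
  construction can be repeated at \<open>q\<close>.\<close>

lemma q_noncut: "noncut_point X q"
proof -
  have "W = topspace X - {q} - {p}"
    by auto
  then have "p \<in> X closure_of W"
    using in_closure_of_open_delete[OF open_delete, of p q] p q by auto
  moreover have "W \<subseteq> X closure_of W"
    by (rule closure_of_subset) auto
  ultimately have "connectedin X (insert p W)"
    using connectedin_intermediate_closure_of[OF connectedin_W, of "insert p W"] by auto
  moreover have "insert p W = topspace X - {q}"
    using p q by auto
  ultimately show ?thesis
    using q by (simp add: noncut_point_def)
qed

lemma W_no_least: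
  assumes "a \<in> W"
  obtains d where "d \<in> W" "lt d a"
proof -
  have "a \<in> topspace Y" "q \<in> topspace Y" "lt q a"
    using assms q q_least by auto
  then obtain d where "d \<in> topspace Y" "lt q d" "lt d a"
    using weakly_ordered.dense[OF ordered connected_Y] by metis
  then show thesis
    using that[of d] W_eq by auto
qed

lemma q_neighbourhood:
  assumes "openin X U" "q \<in> U"
  obtains b where "b \<in> W" "\<And>z. z \<in> W \<Longrightarrow> lt z b \<Longrightarrow> z \<in> U"
proof -
  have UY: "openin Y (U \<inter> (topspace X - {p}))" "q \<in> U \<inter> (topspace X - {p})"
    using assms q by (auto intro: openin_subtopology_Int)
  \<comment> \<open>This serves as the bound when \<open>U\<close> contains all of
    \<open>W\<close>.\<close>
  obtain a where a: "a \<in> W"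
    using W_nonempty by auto
  from weakly_ordered.right_neighbourhood[OF ordered least UY]
  consider "\<forall>z\<in>topspace X - {p}. lt q z \<longrightarrow> z \<in> U"
    | b where "b \<in> topspace X - {p}" "lt q b"
      "\<forall>z\<in>topspace X - {p}. lt q z \<longrightarrow> lt z b \<longrightarrow> z \<in> U"
    unfolding topspace_Y by auto
  then show thesis
  proof cases
    case 1
    then show thesis
      using that[of a] a W_eq by auto
  next
    case 2
    then show thesis
      using that[of b] W_eq by auto
  qed
qed

text \<open>The segment is an upper ray of the converse order. Working in the connected space
  \<open>W\<close> instead of \<open>Y\<close> keeps \<open>q\<close> out of it.\<close>

lemma below_connected:
  assumes "a \<in> W"
  shows "connectedin X {y \<in> W. lt y a}"
proof -
  have WY: "topspace (subtopology X W) = W"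
    by auto
  have "W \<subseteq> topspace X - {p}"
    by auto
  then have "subtopology Y W = subtopology X W"
    by (simp add: subtopology_subtopology inf_absorb2)
  then have "weakly_ordered (subtopology X W) (\<lambda>x y. lt y x)"
    using weakly_ordered_converse[OF weakly_ordered_subtopology[OF ordered, of W]] by simp
  moreover have "connected_space (subtopology X W)"
    using connectedin_W by (simp add: connectedin_def)
  ultimately have "connectedin (subtopology X W) {y \<in> topspace (subtopology X W). lt y a}"
    using assms WY by (intro weakly_ordered.connectedin_above) simp_all
  then show ?thesis
    unfolding WY connectedin_subtopology by simp
qed

lemma q_closure_below:
  assumes "a \<in> W"
  shows "q \<in> X closure_of {y \<in> W. lt y a}"
proof -
  have a: "a \<in> topspace X - {p}" "lt q a"
    using assms q_least by auto
  have "{y \<in> topspace X - {p}. lt y a} - {q} = {y \<in> W. lt y a}"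
    by auto
  then show ?thesis
    using in_closure_of_open_delete[OF openin_Y_imp[OF Y.open_below[OF a(1)]], of q] q a by simp
qed

end

text \<open>The connected complement of \<open>p\<close> lies on one side of \<open>p\<close>, so
  \<open>p\<close> is an end of the order.\<close>

lemma (in weakly_ordered) noncut_point_extremal:
  assumes "connectedin X (topspace X - {p})" "p \<in> topspace X"
  shows "(\<forall>x\<in>topspace X - {p}. lt p x) \<or> (\<forall>x\<in>topspace X - {p}. lt x p)"
proof (rule ccontr)
  assume "\<not> ?thesis"
  then obtain x y where *: "x \<in> topspace X - {p}" "\<not> lt p x" "y \<in> topspace X - {p}" "\<not> lt y p"
    by auto
  then have "lt x p"
    using total[of x p] assms(2) by auto
  then show False
    using connectedin_same_side[OF assms(1,2) _ *(1,3)] *(4) by simp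
qed

lemma selection_imp_min_ordered_complement:
  assumes "connected_space X" "Hausdorff_space X" "infinite (topspace X)" "noncut_point X p"
    and "continuous_selection (subtopology X (topspace X - {p})) f"
  shows "\<exists>lt q. min_ordered_complement X p lt q"
proof -
  let ?Y = "subtopology X (topspace X - {p})"
  have top: "topspace ?Y = topspace X - {p}"
    by auto
  have "connected_space ?Y"
    using assms(4) by (simp add: noncut_point_def connectedin_def)
  then obtain lt where lt: "weakly_ordered ?Y lt" "closed_sets_have_least ?Y lt"
    using continuous_selection_imp_weakly_ordered[OF _ Hausdorff_space_subtopology[OF assms(2)] assms(5)]
    by metis
  have "topspace ?Y \<noteq> {}"
    using assms(3) by (metis top finite.emptyI infinite_remove)
  then obtain q where "q \<in> topspace ?Y" "\<And>s. s \<in> topspace ?Y \<Longrightarrow> s \<noteq> q \<Longrightarrow> lt q s"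
    using closed_sets_have_leastE[OF lt(2) closedin_topspace] by metis
  then have "min_ordered_complement X p lt q"
    unfolding top using assms lt by (intro min_ordered_complement.intro) auto
  then show ?thesis
    by auto
qed

section \<open>Comparing the orders on the complements of two noncut points\<close>

locale min_ordered_complement_pair =
  A: min_ordered_complement X p lt q + B: min_ordered_complement X q lt' r
  for X :: "'a topology" and p lt q lt' r
begin

abbreviation "W \<equiv> topspace X - {p, q}"

lemma W_eq: "topspace X - {q} - {p} = W"
  by auto

lemma p_in: "p \<in> topspace X - {q}"
  using A.p A.q by auto

lemma q_in: "q \<in> topspace X - {p}"
  by (fact A.q)

lemma p_extremal: "(\<forall>x\<in>W. lt' p x) \<or> (\<forall>x\<in>W. lt' x p)"
proof -
  have "connectedin B.Y W"
    using A.connectedin_W unfolding connectedin_subtopology by auto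
  then show ?thesis
    using B.Y.noncut_point_extremal[of p] p_in unfolding W_eq by simp
qed

lemma r_eq_p:
  assumes "\<forall>x\<in>W. lt' p x"
  shows "r = p"
proof (rule ccontr)
  assume "r \<noteq> p"
  then have "lt' r p" "lt' p r"
    using assms B.q p_in B.q_least[of p] by auto
  then show False
    using B.Y.asym[of r p] B.q p_in by simp
qed

lemma r_in_W:
  assumes "\<forall>x\<in>W. lt' x p"
  shows "r \<in> W"
proof -
  obtain x where x: "x \<in> W"
    using A.W_nonempty by auto
  have "r \<noteq> p"
  proof
    assume "r = p"
    then have "lt' p x" "lt' x p"
      using assms x B.q_least[of x] by auto
    then show False
      using B.Y.asym[of x p] x p_in by simp
  qed
  then show ?thesis
    using B.q by auto
qed

text \<open>Both orders restrict to weak orders of the connected space \<open>W\<close>, where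
  \<open>orders_agree\<close> applies; totality turns its implications into equivalences.\<close>

lemma same_or_opposite:
  "(\<forall>x\<in>W. \<forall>y\<in>W. lt x y \<longleftrightarrow> lt' x y) \<or> (\<forall>x\<in>W. \<forall>y\<in>W. lt x y \<longleftrightarrow> lt' y x)"
proof -
  have top: "topspace (subtopology X W) = W"
    by auto
  have "W \<subseteq> topspace X - {p}" "W \<subseteq> topspace X - {q}"
    by auto
  then have "subtopology A.Y W = subtopology X W" "subtopology B.Y W = subtopology X W"
    by (simp_all add: subtopology_subtopology inf_absorb2)
  then have wo: "weakly_ordered (subtopology X W) lt" and wo': "weakly_ordered (subtopology X W) lt'"
    using weakly_ordered_subtopology[OF A.ordered, of W] weakly_ordered_subtopology[OF B.ordered, of W]
    by simp_all
  have conn: "connected_space (subtopology X W)"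
    using A.connectedin_W by (simp add: connectedin_def)
  consider "\<forall>x\<in>W. \<forall>y\<in>W. lt x y \<longrightarrow> lt' x y" | "\<forall>x\<in>W. \<forall>y\<in>W. lt x y \<longrightarrow> lt' y x"
    using weakly_ordered.orders_agree[OF wo conn wo'] unfolding top by auto
  then show ?thesis
  proof cases
    case 1
    have "lt x y \<longleftrightarrow> lt' x y" if "x \<in> W" "y \<in> W" for x y
      using 1 A.Y.total[of x y] B.Y.asym[of x y] B.Y.irrefl[of x] that by auto
    then show ?thesis by simp
  next
    case 2
    have "lt x y \<longleftrightarrow> lt' y x" if "x \<in> W" "y \<in> W" for x y
      using 2 A.Y.total[of x y] B.Y.asym[of x y] B.Y.irrefl[of x] that by auto
    then show ?thesis by simp
  qed
qed

text \<open>Here \<open>p\<close> and \<open>q\<close> are both approached by the low end of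
  \<open>W\<close> in the same order, so sufficiently small points of \<open>W\<close> lie in any
  neighbourhood of either, against the Hausdorff property.\<close>

lemma not_below_same:
  assumes "\<forall>x\<in>W. lt' p x" and same: "\<forall>x\<in>W. \<forall>y\<in>W. lt x y \<longleftrightarrow> lt' x y"
  shows False
proof -
  have r: "r = p"
    using r_eq_p assms by blast
  obtain U V where UV: "openin X U" "openin X V" "p \<in> U" "q \<in> V" "disjnt U V"
    using A.Hausdorff[unfolded Hausdorff_space_def, rule_format, of p q] p_in q_in by auto
  obtain b where b: "b \<in> W" "\<And>z. z \<in> W \<Longrightarrow> lt z b \<Longrightarrow> z \<in> V"
    using A.q_neighbourhood[OF UV(2,4)] by metis
  have rU: "r \<in> U" and W': "topspace X - {q, r} = W"
    using r UV by auto
  obtain b' where b': "b' \<in> W" "\<And>z. z \<in> W \<Longrightarrow> lt' z b' \<Longrightarrow> z \<in> U"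
    using B.q_neighbourhood[OF UV(1) rU] unfolding W' by metis
  obtain d where d: "d \<in> W" "lt d b" "lt d b'"
  proof (cases "b = b' \<or> lt b b'")
    case True
    obtain d where "d \<in> W" "lt d b"
      using A.W_no_least[OF b(1)] by metis
    then show thesis
      using that[of d] True A.Y.trans[of d b b'] b(1) b'(1) by auto
  next
    case False
    then have "lt b' b"
      using A.Y.total[of b b'] b(1) b'(1) by auto
    obtain d where "d \<in> W" "lt d b'"
      using A.W_no_least[OF b'(1)] by metis
    then show thesis
      using that[of d] \<open>lt b' b\<close> A.Y.trans[of d b' b] b(1) b'(1) by auto
  qed
  have "d \<in> U"
    using b' d same by auto
  moreover have "d \<in> V"
    using b d by auto
  ultimately show False
    using UV(5) by (auto simp: disjnt_iff)
qed

text \<open>The point \<open>r\<close> would be a least point of \<open>W\<close> for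
  \<open>lt\<close>, which \<open>W_no_least\<close> excludes.\<close>

lemma not_above_same:
  assumes "\<forall>x\<in>W. lt' x p" and same: "\<forall>x\<in>W. \<forall>y\<in>W. lt x y \<longleftrightarrow> lt' x y"
  shows False
proof -
  have r: "r \<in> W"
    using r_in_W assms by blast
  then obtain d where d: "d \<in> W" "lt d r"
    using A.W_no_least by metis
  have "lt' d r"
    using same d r by auto
  moreover from this have "lt' r d"
    using B.q_least[of d] B.Y.irrefl[of d] d by auto
  ultimately show False
    using B.Y.asym[of d r] d r by auto
qed

text \<open>The \<open>lt'\<close>-ray above \<open>a\<close> is an open set containing
  \<open>p\<close>; without \<open>p\<close> it is the \<open>lt\<close>-segment below
  \<open>a\<close>. So \<open>p\<close> is a limit at the same end of \<open>W\<close> as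
  \<open>q\<close>.\<close>

lemma p_closure_below:
  assumes "\<forall>x\<in>W. lt' x p" "\<forall>x\<in>W. \<forall>y\<in>W. lt x y \<longleftrightarrow> lt' y x" and a: "a \<in> W"
  shows "p \<in> X closure_of {y \<in> W. lt y a}"
proof -
  have aZ: "a \<in> topspace X - {q}"
    using a by auto
  have "{y \<in> topspace X - {q}. lt' a y} - {p} = {y \<in> W. lt y a}"
    using assms by auto
  moreover have "p \<in> {y \<in> topspace X - {q}. lt' a y}"
    using assms p_in by auto
  ultimately show ?thesis
    using A.in_closure_of_open_delete[OF B.openin_Y_imp[OF B.Y.open_above[OF aZ]], of p] by simp
qed

lemma connectedin_add_ends:
  assumes "\<forall>x\<in>W. lt' x p" "\<forall>x\<in>W. \<forall>y\<in>W. lt x y \<longleftrightarrow> lt' y x" "a \<in> W" "E \<subseteq> {p, q}"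
  shows "connectedin X (E \<union> {y \<in> W. lt y a})"
proof (rule connectedin_intermediate_closure_of[OF A.below_connected[OF assms(3)]])
  have "{y \<in> W. lt y a} \<subseteq> X closure_of {y \<in> W. lt y a}"
    by (rule closure_of_subset) auto
  then show "E \<union> {y \<in> W. lt y a} \<subseteq> X closure_of {y \<in> W. lt y a}"
    using assms(4) p_closure_below[OF assms(1-3)] A.q_closure_below[OF assms(3)] by auto
qed auto

text \<open>The contradiction comes from a third order, on the complement of \<open>r\<close>. There
  \<open>p\<close> and \<open>q\<close> are noncut points, hence opposite ends, and any further
  point separates them; yet they lie in a connected set avoiding such a point.\<close>

lemma not_above_opposite:
  assumes above: "\<forall>x\<in>W. lt' x p" and opp: "\<forall>x\<in>W. \<forall>y\<in>W. lt x y \<longleftrightarrow> lt' y x"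
    and sel: "\<And>p. noncut_point X p \<Longrightarrow>
           \<exists>f. continuous_selection (subtopology X (topspace X - {p})) f"
  shows False
proof -
  have r: "r \<in> W"
    using r_in_W above by blast
  \<comment> \<open>As first point for \<open>lt'\<close>, \<open>r\<close> is the last point of
    \<open>W\<close> for \<open>lt\<close>, so the segment below \<open>r\<close> is all of
    \<open>W\<close> except \<open>r\<close>.\<close>
  have Lr: "{y \<in> W. lt y r} = W - {r}"
    using A.Y.irrefl[of r] r opp B.q_least by auto
  have conn: "connectedin X (topspace X - {r})"
    "connectedin X (topspace X - {r} - {p})" "connectedin X (topspace X - {r} - {q})"
  proof -
    have "topspace X - {r} = {p, q} \<union> {y \<in> W. lt y r}"
      "topspace X - {r} - {p} = {q} \<union> {y \<in> W. lt y r}"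
      "topspace X - {r} - {q} = {p} \<union> {y \<in> W. lt y r}"
      unfolding Lr using r p_in q_in by auto
    then show "connectedin X (topspace X - {r})"
      "connectedin X (topspace X - {r} - {p})" "connectedin X (topspace X - {r} - {q})"
      using connectedin_add_ends[OF above opp r, of "{p, q}"]
        connectedin_add_ends[OF above opp r, of "{p}"]
        connectedin_add_ends[OF above opp r, of "{q}"] by simp_all
  qed
  have "noncut_point X r"
    using r conn(1) by (simp add: noncut_point_def)
  then obtain lt'' s where "min_ordered_complement X r lt'' s"
    using sel selection_imp_min_ordered_complement[OF A.connected A.Hausdorff A.inf] by metis
  then interpret C: min_ordered_complement X r lt'' s .
  have pY: "p \<in> topspace X - {r}" and qY: "q \<in> topspace X - {r}" and pq: "p \<noteq> q"
    using p_in q_in r by auto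
  have p_ext: "(\<forall>x\<in>topspace X - {r} - {p}. lt'' p x) \<or> (\<forall>x\<in>topspace X - {r} - {p}. lt'' x p)"
    using C.Y.noncut_point_extremal[OF _ pY] conn(2) unfolding connectedin_subtopology by auto
  have q_ext: "(\<forall>x\<in>topspace X - {r} - {q}. lt'' q x) \<or> (\<forall>x\<in>topspace X - {r} - {q}. lt'' x q)"
    using C.Y.noncut_point_extremal[OF _ qY] conn(3) unfolding connectedin_subtopology by auto
  obtain a where a: "a \<in> W" "lt a r"
    using A.W_no_least[OF r] by metis
  then have ar: "a \<noteq> r"
    using Lr by auto
  have asym: "\<not> (lt'' x y \<and> lt'' y x)" if "x \<in> topspace X - {r}" "y \<in> topspace X - {r}" for x y
    using C.Y.asym[OF that] by auto
  \<comment> \<open>This set joins \<open>p\<close> and \<open>q\<close> through the points of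
    \<open>W\<close> below \<open>a\<close>, avoiding both \<open>a\<close> and \<open>r\<close>. So
    \<open>p\<close> and \<open>q\<close> lie on the same side of \<open>a\<close> for
    \<open>lt''\<close>.\<close>
  let ?C = "{p, q} \<union> {y \<in> W. lt y a}"
  have aC: "a \<notin> ?C" and aY: "a \<in> topspace X - {r}"
    using a ar A.Y.irrefl[of a] by auto
  have "r \<notin> ?C"
    using r a A.Y.asym[of a r] by auto
  then have "?C \<subseteq> topspace X - {r}"
    using pY qY by auto
  then have C: "connectedin C.Y ?C"
    using connectedin_add_ends[OF above opp a(1), of "{p, q}"] unfolding connectedin_subtopology by auto
  have "lt'' p a \<longleftrightarrow> lt'' q a"
    using C.Y.connectedin_same_side[OF C aY aC, of p q] C.Y.connectedin_same_side[OF C aY aC, of q p]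
    by auto
  moreover have "a \<in> topspace X - {r} - {p}" "a \<in> topspace X - {r} - {q}"
    "q \<in> topspace X - {r} - {p}" "p \<in> topspace X - {r} - {q}"
    using a ar pY qY pq by auto
  ultimately show False
    using p_ext q_ext asym[OF pY qY] asym[OF pY aY] asym[OF qY aY] by metis
qed

lemma below_opposite_imp:
  assumes below: "\<forall>x\<in>W. lt' p x" and opp: "\<forall>x\<in>W. \<forall>y\<in>W. lt x y \<longleftrightarrow> lt' y x"
  shows "compact_space X \<and> orderable_space X"
proof -
  \<comment> \<open>\<open>lt0\<close> extends \<open>lt\<close> to all of \<open>X\<close> with
    \<open>p\<close> as last point; \<open>q\<close> remains the first.\<close>
  define lt0 where "lt0 x y \<longleftrightarrow> x \<noteq> p \<and> (y = p \<or> lt x y)" for x y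
  have not_lt_q: "\<not> lt x q" if "x \<in> topspace X - {p}" for x
    using A.q_least[OF that] A.Y.asym[OF that q_in] A.Y.irrefl[OF q_in] by auto
  have "weakly_ordered X lt0"
  proof unfold_locales
    show "\<not> lt0 x x" if "x \<in> topspace X" for x
      using A.Y.irrefl[of x] that by (auto simp: lt0_def)
    show "lt0 x z"
      if "x \<in> topspace X" "y \<in> topspace X" "z \<in> topspace X" "lt0 x y" "lt0 y z" for x y z
      using A.Y.trans[of x y z] that by (auto simp: lt0_def)
    show "lt0 x y \<or> lt0 y x" if "x \<in> topspace X" "y \<in> topspace X" "x \<noteq> y" for x y
      using A.Y.total[of x y] that by (auto simp: lt0_def)
  next
    fix x assume x: "x \<in> topspace X"
    show "openin X {y \<in> topspace X. lt0 y x}"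
    proof (cases "x = p")
      case True
      then have "{y \<in> topspace X. lt0 y x} = topspace X - {p}"
        by (auto simp: lt0_def)
      then show ?thesis
        using A.open_delete by simp
    next
      case False
      then have "{y \<in> topspace X. lt0 y x} = {y \<in> topspace X - {p}. lt y x}"
        by (auto simp: lt0_def)
      then show ?thesis
        using A.openin_Y_imp[OF A.Y.open_below[of x]] x False by simp
    qed
    consider "x = p" | "x = q" "x \<noteq> p" | "x \<in> W"
      using x by auto
    then show "openin X {y \<in> topspace X. lt0 x y}"
    proof cases
      case 1
      then have "{y \<in> topspace X. lt0 x y} = {}"
        by (auto simp: lt0_def)
      then show ?thesis
        by (simp only: openin_empty)
    next
      case 2
      then have "{y \<in> topspace X. lt0 x y} = topspace X - {q}"
        using A.q_least A.Y.irrefl[OF q_in] by (auto simp: lt0_def)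
      then show ?thesis
        using A.open_delete by simp
    next
      \<comment> \<open>This ray contains \<open>p\<close>, so its openness cannot be taken from
        \<open>lt\<close>; it is a lower ray of \<open>lt'\<close>, open in the complement of
        \<open>q\<close> and hence in \<open>X\<close>.\<close>
      case 3
      then have "{y \<in> topspace X. lt0 x y} = {y \<in> topspace X - {q}. lt' y x}"
        using below opp not_lt_q[of x] p_in by (auto simp: lt0_def)
      then show ?thesis
        using B.openin_Y_imp[OF B.Y.open_below[of x]] 3 by simp
    qed
  qed
  moreover have "closed_sets_have_least X lt0"
    by (rule closed_sets_have_least_glue[OF A.least]) (auto simp: lt0_def)
  \<comment> \<open>The converse of \<open>lt0\<close> extends \<open>lt'\<close> by
    \<open>q\<close> as last point, so the minima for \<open>lt'\<close> become maxima for
    \<open>lt0\<close>.\<close>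
  moreover have "closed_sets_have_least X (\<lambda>x y. lt0 y x)"
  proof (rule closed_sets_have_least_glue[OF B.least])
    show "lt0 q x" if "x \<in> topspace X - {q}" for x
      using that A.q_least[of x] q_in by (auto simp: lt0_def)
    show "lt0 y x" if xy: "x \<in> topspace X - {q}" "y \<in> topspace X - {q}" "lt' x y" for x y
    proof -
      have "y \<noteq> p"
      proof
        assume y: "y = p"
        then have "lt' p x"
          using below xy B.Y.irrefl[OF xy(2)] by (cases "x = p") auto
        then show False
          using y B.Y.asym[OF xy] by simp
      qed
      then show ?thesis
        using opp xy by (auto simp: lt0_def)
    qed
  qed
  ultimately show ?thesis
    using weakly_ordered_min_max_imp_orderable weakly_ordered_min_max_imp_compact by metis
qed

end

theorem theorem3p3:
  fixes X :: "'a topology"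
  assumes "infinite (topspace X)"
    and "connected_space X"
    and "Hausdorff_space X"
    and "\<exists>p. noncut_point X p"
    and "\<And>p. noncut_point X p \<Longrightarrow>
           \<exists>f. continuous_selection (subtopology X (topspace X - {p})) f"
  shows "compact_space X \<and> orderable_space X"
proof -
  have ex: "\<exists>lt q. min_ordered_complement X p lt q" if "noncut_point X p" for p
    using selection_imp_min_ordered_complement[OF assms(2,3,1) that] assms(5)[OF that] by auto
  obtain p lt q where A: "min_ordered_complement X p lt q"
    using assms(4) ex by metis
  obtain lt' r where B: "min_ordered_complement X q lt' r"
    using ex[OF min_ordered_complement.q_noncut[OF A]] by auto
  interpret min_ordered_complement_pair X p lt q lt' r
    using A B by (rule min_ordered_complement_pair.intro)
  \<comment> \<open>Of the four combinations of \<open>same_or_opposite\<close> with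
    \<open>p_extremal\<close>, only opposite orders with \<open>p\<close> first for
    \<open>lt'\<close> can occur.\<close>
  show ?thesis
    using same_or_opposite
  proof
    assume "\<forall>x\<in>W. \<forall>y\<in>W. lt x y \<longleftrightarrow> lt' x y"
    then show ?thesis
      using p_extremal not_below_same not_above_same by argo
  next
    assume opp: "\<forall>x\<in>W. \<forall>y\<in>W. lt x y \<longleftrightarrow> lt' y x"
    have "\<not> (\<forall>x\<in>W. lt' x p)"
    proof
      assume "\<forall>x\<in>W. lt' x p"
      then show False
        using opp by (rule not_above_opposite) (fact assms(5))
    qed
    then have "\<forall>x\<in>W. lt' p x"
      using p_extremal by argo
    then show ?thesis
      using opp by (rule below_opposite_imp)
  qed
qed

end
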